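(* Let $A,B\in\mathcal{B}(\mathcal{H})$ be positive operators and $0\le t\le 1$. Then $\left(A\sharp_{1-t}B\right)^{-1}$ is the unique positive solution $\mathbb{X}$ of the equation $$A^{\frac12}B^{\frac12}\,\mathbb{X}\,\left(A^{\frac12}B^{\frac12}\right)^*=A\natural_t B .$$
   Context: $\mathcal{B}(\mathcal{H})$ is the $C^*$-algebra of bounded linear operators on a complex Hilbert space $\mathcal{H}$. "Positive" means $\langle Tx,x\rangle>0$ for all nonzero $x$ and $T$ is invertible in $\mathcal{B}(\mathcal{H})$. For positive $A,B$ and $0\le t\le1$: $A\sharp_t B:=A^{\frac12}\left(A^{-\frac12}BA^{-\frac12}\right)^{t}A^{\frac12}$ and $A\natural_t B:=A^{\frac12}\left(B^{\frac12}A^{-1}B^{\frac12}\right)^{t}A^{\frac12}$. *)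

theory Defs
  imports "HOL-Analysis.Analysis" "HOL-Computational_Algebra.Polynomial"
begin

text \<open>
  The class \<open>real_inner\<close> supplies the underlying real Hilbert space; its inner product
  is the real part of the complex one, so norm and topology are the usual ones.
  The complex inner product is linear in the first argument.
\<close>

class complex_hilbert = real_inner + banach +
  fixes scaleC :: "complex \<Rightarrow> 'a \<Rightarrow> 'a" (infixr "*\<^sub>C" 75)
    and cinner :: "'a \<Rightarrow> 'a \<Rightarrow> complex"
  assumes scaleC_add_right: "c *\<^sub>C (x + y) = c *\<^sub>C x + c *\<^sub>C y"
    and scaleC_add_left: "(c + d) *\<^sub>C x = c *\<^sub>C x + d *\<^sub>C x"
    and scaleC_scaleC: "c *\<^sub>C (d *\<^sub>C x) = (c * d) *\<^sub>C x"
    and scaleC_of_real: "complex_of_real r *\<^sub>C x = r *\<^sub>R x"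
    and cinner_add_left: "cinner (x + y) z = cinner x z + cinner y z"
    and cinner_scaleC_left: "cinner (c *\<^sub>C x) y = c * cinner x y"
    and cinner_commute: "cinner x y = cnj (cinner y x)"
    and inner_eq_Re_cinner: "inner x y = Re (cinner x y)"

lemma cinner_scaleC_right:
  fixes x y :: "'a::complex_hilbert"
  shows "cinner x (c *\<^sub>C y) = cnj c * cinner x y"
  by (metis cinner_commute cinner_scaleC_left complex_cnj_mult)

lemma norm_scaleC:
  fixes x :: "'a::complex_hilbert"
  shows "norm (c *\<^sub>C x) = cmod c * norm x"
proof -
  have "inner (c *\<^sub>C x) (c *\<^sub>C x) = Re ((c * cnj c) * cinner x x)"
    by (simp only: inner_eq_Re_cinner cinner_scaleC_left cinner_scaleC_right mult_ac)
  also have "c * cnj c = complex_of_real ((cmod c)\<^sup>2)"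
    by (rule complex_norm_square[symmetric])
  also have "Re (complex_of_real ((cmod c)\<^sup>2) * cinner x x) = (cmod c)\<^sup>2 * inner x x"
    by (simp only: Re_complex_of_real Im_complex_of_real times_complex.sel inner_eq_Re_cinner mult_zero_left diff_zero)
  finally show ?thesis
    by (simp add: norm_eq_sqrt_inner real_sqrt_mult)
qed

lemma scaleC_scaleR:
  fixes x :: "'a::complex_hilbert"
  shows "c *\<^sub>C (r *\<^sub>R x) = r *\<^sub>R (c *\<^sub>C x)"
  by (metis scaleC_scaleC scaleC_of_real mult.commute)

lemma bounded_linear_scaleC: "bounded_linear (\<lambda>x::'a::complex_hilbert. c *\<^sub>C x)"
  by (rule bounded_linear_intro[where K = "cmod c"])
     (simp_all add: scaleC_add_right scaleC_scaleR norm_scaleC mult.commute)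

text \<open>The algebra of bounded complex-linear operators, with the operator norm.\<close>

typedef (overloaded) ('a::complex_hilbert) bop =
  "{T :: 'a \<Rightarrow>\<^sub>L 'a. \<forall>c x. blinfun_apply T (c *\<^sub>C x) = c *\<^sub>C blinfun_apply T x}"
  morphisms blinfun_of_bop bop_of_blinfun
  by (rule exI[of _ id_blinfun]) simp

setup_lifting type_definition_bop

lift_definition bop_apply :: "'a::complex_hilbert bop \<Rightarrow> 'a \<Rightarrow> 'a" (infixr "\<cdot>" 70)
  is blinfun_apply .

instantiation bop :: (complex_hilbert) real_normed_vector
begin

lift_definition zero_bop :: "'a bop" is 0
  by (metis blinfun.zero_left diff_self scaleC_add_right add_cancel_right_right)
lift_definition plus_bop :: "'a bop \<Rightarrow> 'a bop \<Rightarrow> 'a bop" is "(+)"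
  by (simp add: blinfun.add_left scaleC_add_right)
lift_definition scaleR_bop :: "real \<Rightarrow> 'a bop \<Rightarrow> 'a bop" is "scaleR"
  by (simp add: blinfun.scaleR_left scaleC_scaleR)
lift_definition uminus_bop :: "'a bop \<Rightarrow> 'a bop" is uminus
  by (metis blinfun.minus_left scaleR_minus1_left scaleC_scaleR)
lift_definition minus_bop :: "'a bop \<Rightarrow> 'a bop \<Rightarrow> 'a bop" is "(-)"
  by (metis blinfun.diff_left add_diff_cancel diff_add_cancel scaleC_add_right)
lift_definition norm_bop :: "'a bop \<Rightarrow> real" is norm .

definition dist_bop :: "'a bop \<Rightarrow> 'a bop \<Rightarrow> real"
  where "dist_bop S T = norm (S - T)"
definition sgn_bop :: "'a bop \<Rightarrow> 'a bop"
  where "sgn_bop T = inverse (norm T) *\<^sub>R T"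
definition uniformity_bop :: "('a bop \<times> 'a bop) filter"
  where "uniformity_bop = (INF e\<in>{0<..}. principal {(S, T). dist S T < e})"
definition open_bop :: "'a bop set \<Rightarrow> bool"
  where "open_bop U = (\<forall>S\<in>U. \<forall>\<^sub>F (S', T) in uniformity. S' = S \<longrightarrow> T \<in> U)"

instance
proof
  fix S T U :: "'a bop" and a b :: real
  show "S + T + U = S + (T + U)" by transfer (simp add: algebra_simps)
  show "S + T = T + S" by transfer (simp add: algebra_simps)
  show "0 + S = S" by transfer simp
  show "- S + S = 0" by transfer simp
  show "S - T = S + - T" by transfer simp
  show "a *\<^sub>R (S + T) = a *\<^sub>R S + a *\<^sub>R T" by transfer (simp add: algebra_simps)
  show "(a + b) *\<^sub>R S = a *\<^sub>R S + b *\<^sub>R S" by transfer (simp add: algebra_simps)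
  show "a *\<^sub>R b *\<^sub>R S = (a * b) *\<^sub>R S" by transfer simp
  show "1 *\<^sub>R S = S" by transfer simp
  show "norm S = 0 \<longleftrightarrow> S = 0" by transfer simp
  show "norm (S + T) \<le> norm S + norm T" by transfer (rule norm_triangle_ineq)
  show "norm (a *\<^sub>R S) = \<bar>a\<bar> * norm S" by transfer simp
qed (simp_all add: dist_bop_def sgn_bop_def uniformity_bop_def open_bop_def)

end

text \<open>
  Multiplication is composition. Since \<open>1 = 0\<close> on the zero space, the class
  \<open>real_normed_algebra_1\<close> is not available.
\<close>

instantiation bop :: (complex_hilbert) "{real_normed_algebra, monoid_mult}"
begin

lift_definition one_bop :: "'a bop" is id_blinfun by simp
lift_definition times_bop :: "'a bop \<Rightarrow> 'a bop \<Rightarrow> 'a bop" is blinfun_compose by simp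

instance
proof
  fix S T U :: "'a bop" and a :: real
  show "S * T * U = S * (T * U)" by transfer (simp add: blinfun_eqI)
  show "1 * S = S" by transfer (simp add: blinfun_eqI)
  show "S * 1 = S" by transfer (simp add: blinfun_eqI)
  show "(S + T) * U = S * U + T * U"
    by transfer (simp add: blinfun_eqI blinfun.add_left)
  show "S * (T + U) = S * T + S * U"
    by transfer (simp add: blinfun_eqI blinfun.add_left blinfun.add_right)
  show "a *\<^sub>R S * T = a *\<^sub>R (S * T)"
    by transfer (simp add: blinfun_eqI blinfun.scaleR_left)
  show "S * a *\<^sub>R T = a *\<^sub>R (S * T)"
    by transfer (simp add: blinfun_eqI blinfun.scaleR_left blinfun.scaleR_right)
  show "norm (S * T) \<le> norm S * norm T" by transfer (rule norm_blinfun_compose)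
qed

end

lift_definition scalar_op :: "complex \<Rightarrow> 'a::complex_hilbert bop"
  is "\<lambda>c. Blinfun (\<lambda>x. c *\<^sub>C x)"
  by (simp add: bounded_linear_Blinfun_apply bounded_linear_scaleC scaleC_scaleC mult.commute)

definition invertible_op :: "'a::complex_hilbert bop \<Rightarrow> bool"
  where "invertible_op T \<longleftrightarrow> (\<exists>S. S * T = 1 \<and> T * S = 1)"

definition inv_op :: "'a::complex_hilbert bop \<Rightarrow> 'a bop"
  where "inv_op T = (THE S. S * T = 1 \<and> T * S = 1)"

definition adj_op :: "'a::complex_hilbert bop \<Rightarrow> 'a bop"
  where "adj_op T = (THE S. \<forall>x y. cinner (T \<cdot> x) y = cinner x (S \<cdot> y))"

definition positive_op :: "'a::complex_hilbert bop \<Rightarrow> bool"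
  where "positive_op T \<longleftrightarrow>
    (\<forall>x. x \<noteq> 0 \<longrightarrow> cinner (T \<cdot> x) x \<in> \<real> \<and> Re (cinner (T \<cdot> x) x) > 0) \<and> invertible_op T"

definition spectrum_op :: "'a::complex_hilbert bop \<Rightarrow> complex set"
  where "spectrum_op T = {c. \<not> invertible_op (T - scalar_op c)}"

definition poly_op :: "real poly \<Rightarrow> 'a::complex_hilbert bop \<Rightarrow> 'a bop"
  where "poly_op p T = (\<Sum>i\<le>degree p. coeff p i *\<^sub>R T ^ i)"

text \<open>
  Continuous functional calculus \<open>f(T)\<close> for selfadjoint \<open>T\<close> and real-valued \<open>f\<close>
  continuous on the spectrum: the norm limit of \<open>p\<^sub>n(T)\<close> for any real polynomials
  \<open>p\<^sub>n\<close> tending to \<open>f\<close> uniformly on the spectrum, which is then a compact set of reals.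
  Nothing is intended for other \<open>T\<close> or \<open>f\<close>.
\<close>

definition cfc :: "(real \<Rightarrow> real) \<Rightarrow> 'a::complex_hilbert bop \<Rightarrow> 'a bop"
  where "cfc f T = (THE S. \<exists>p :: nat \<Rightarrow> real poly.
    uniform_limit {r. complex_of_real r \<in> spectrum_op T} (\<lambda>n. poly (p n)) f sequentially \<and>
    (\<lambda>n. poly_op (p n) T) \<longlonglongrightarrow> S)"

definition powr_op :: "'a::complex_hilbert bop \<Rightarrow> real \<Rightarrow> 'a bop"
  where "powr_op T t = cfc (\<lambda>r. r powr t) T"

abbreviation sqrt_op :: "'a::complex_hilbert bop \<Rightarrow> 'a bop"
  where "sqrt_op T \<equiv> powr_op T (1/2)"

definition sharp_op :: "'a::complex_hilbert bop \<Rightarrow> real \<Rightarrow> 'a bop \<Rightarrow> 'a bop"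
    ("(_ \<sharp>\<^bsub>_\<^esub> _)" [71, 0, 71] 70)
  where "A \<sharp>\<^bsub>t\<^esub> B =
    sqrt_op A * powr_op (powr_op A (-1/2) * B * powr_op A (-1/2)) t * sqrt_op A"

definition natural_op :: "'a::complex_hilbert bop \<Rightarrow> real \<Rightarrow> 'a bop \<Rightarrow> 'a bop"
    ("(_ \<natural>\<^bsub>_\<^esub> _)" [71, 0, 71] 70)
  where "A \<natural>\<^bsub>t\<^esub> B =
    sqrt_op A * powr_op (sqrt_op B * inv_op A * sqrt_op B) t * sqrt_op A"

end

theory Submission
  imports Defs "HOL-Computational_Algebra.Fundamental_Theorem_Algebra"
begin

text \<open>
  Put \<open>Z = A\<^sup>-\<^sup>1\<^sup>/\<^sup>2 B\<^sup>1\<^sup>/\<^sup>2\<close>, so that \<open>Z Z\<^sup>* = A\<^sup>-\<^sup>1\<^sup>/\<^sup>2 B A\<^sup>-\<^sup>1\<^sup>/\<^sup>2\<close> and \<open>Z\<^sup>* Z = B\<^sup>1\<^sup>/\<^sup>2 A\<^sup>-\<^sup>1 B\<^sup>1\<^sup>/\<^sup>2\<close>.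
  The inverse of the weighted mean is \<open>A\<^sup>-\<^sup>1\<^sup>/\<^sup>2 (Z Z\<^sup>*)\<^sup>t\<^sup>-\<^sup>1 A\<^sup>-\<^sup>1\<^sup>/\<^sup>2\<close>, and the equation reduces to
  \<open>Z\<^sup>* (Z Z\<^sup>*)\<^sup>t\<^sup>-\<^sup>1 Z = (Z\<^sup>* Z)\<^sup>t\<close>, which follows from \<open>(Z Z\<^sup>*) Z = Z (Z\<^sup>* Z)\<close> by passing from polynomials
  to powers. Uniqueness holds because \<open>A\<^sup>1\<^sup>/\<^sup>2 B\<^sup>1\<^sup>/\<^sup>2\<close> is invertible.

  The functional calculus rests on \<open>\<parallel>p(T)\<parallel> \<le> sup |p|\<close> over the real spectrum of a selfadjoint \<open>T\<close>:
  one of \<open>\<plusminus>\<parallel>p(T)\<parallel>\<close> is in the spectrum of \<open>p(T)\<close>, and it is a value of \<open>p\<close> on the spectrum of \<open>T\<close> since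
  a real polynomial splits into linear factors and factors \<open>(x - a)\<^sup>2 + b\<^sup>2\<close>, at which \<open>T\<close> is coercive.
\<close>

section \<open>Bounded operators\<close>

lemma bop_eqI: "(\<And>x. S \<cdot> x = T \<cdot> x) \<Longrightarrow> S = T"
  by transfer (rule blinfun_eqI)

lemma bop_apply_simps [simp]:
  "(S + T) \<cdot> x = S \<cdot> x + T \<cdot> x"
  "(S - T) \<cdot> x = S \<cdot> x - T \<cdot> x"
  "(- T) \<cdot> x = - (T \<cdot> x)"
  "(r *\<^sub>R T) \<cdot> x = r *\<^sub>R (T \<cdot> x)"
  "(S * T) \<cdot> x = S \<cdot> (T \<cdot> x)"
  "0 \<cdot> x = 0"
  "1 \<cdot> x = x"
  by (transfer; simp add: blinfun.bilinear_simps)+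

lemma bop_apply_right:
  "T \<cdot> (x + y) = T \<cdot> x + T \<cdot> y"
  "T \<cdot> (x - y) = T \<cdot> x - T \<cdot> y"
  "T \<cdot> (r *\<^sub>R x) = r *\<^sub>R (T \<cdot> x)"
  "T \<cdot> 0 = 0"
  by (transfer; simp add: blinfun.bilinear_simps)+

lemma bop_apply_scaleC: "T \<cdot> (c *\<^sub>C x) = c *\<^sub>C (T \<cdot> x)"
  by transfer simp

lemma norm_bop_apply: "norm (T \<cdot> x) \<le> norm T * norm x"
  by transfer (rule norm_blinfun)

lemma norm_bop_le:
  assumes "0 \<le> b" "\<And>x. norm (T \<cdot> x) \<le> b * norm x"
  shows "norm T \<le> b"
  using assms by transfer (rule norm_blinfun_bound)

lemma bounded_linear_bop_apply_left: "bounded_linear (\<lambda>T. T \<cdot> x)"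
  by (rule bounded_linear_intro[where K = "norm x"])
     (use norm_bop_apply[of _ x] in \<open>simp_all\<close>)

instance bop :: (complex_hilbert) banach
proof
  fix X :: "nat \<Rightarrow> 'a bop"
  assume "Cauchy X"
  have "Cauchy (\<lambda>n. blinfun_of_bop (X n))"
    using \<open>Cauchy X\<close> unfolding Cauchy_def dist_norm
    by (simp add: norm_bop.rep_eq minus_bop.rep_eq)
  then obtain L where L: "(\<lambda>n. blinfun_of_bop (X n)) \<longlonglongrightarrow> L"
    using Cauchy_convergent convergent_def by blast
  \<comment> \<open>Complex linearity passes to pointwise limits, so the limit taken among the
    bounded real-linear maps is again an element of the type.\<close>
  have "blinfun_apply L (c *\<^sub>C x) = c *\<^sub>C blinfun_apply L x" for c x
  proof (rule LIMSEQ_unique)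
    show "(\<lambda>n. X n \<cdot> (c *\<^sub>C x)) \<longlonglongrightarrow> blinfun_apply L (c *\<^sub>C x)"
      unfolding bop_apply.rep_eq by (intro blinfun.tendsto L tendsto_const)
    have "(\<lambda>n. c *\<^sub>C (X n \<cdot> x)) \<longlonglongrightarrow> c *\<^sub>C blinfun_apply L x"
      unfolding bop_apply.rep_eq
      by (intro bounded_linear.tendsto[OF bounded_linear_scaleC] blinfun.tendsto L tendsto_const)
    then show "(\<lambda>n. X n \<cdot> (c *\<^sub>C x)) \<longlonglongrightarrow> c *\<^sub>C blinfun_apply L x"
      by (simp add: bop_apply_scaleC)
  qed
  then have "blinfun_of_bop (bop_of_blinfun L) = L"
    by (simp add: bop_of_blinfun_inverse)
  then have "X \<longlonglongrightarrow> bop_of_blinfun L"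
    using L unfolding tendsto_iff dist_norm
    by (simp add: norm_bop.rep_eq minus_bop.rep_eq)
  then show "convergent X"
    by (auto simp: convergent_def)
qed

section \<open>Inverses, lower bounds and coercivity\<close>

lemma inv_op_eqI:
  assumes "S * T = 1" "T * S = 1"
  shows "inv_op T = S"
  unfolding inv_op_def
proof (rule the_equality)
  fix U assume "U * T = 1 \<and> T * U = 1"
  then show "U = S"
    by (metis assms(2) mult.assoc mult.left_neutral mult.right_neutral)
qed (use assms in simp)

lemma inv_op:
  assumes "invertible_op T"
  shows "inv_op T * T = 1" "T * inv_op T = 1"
  using assms inv_op_eqI unfolding invertible_op_def by blast+

lemma invertible_op_mult:
  assumes "invertible_op S" "invertible_op T"
  shows "invertible_op (S * T)"
proof -
  have "inv_op T * inv_op S * (S * T) = 1" "S * T * (inv_op T * inv_op S) = 1"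
    by (metis assms inv_op mult.assoc mult.right_neutral)+
  then show ?thesis
    unfolding invertible_op_def by blast
qed

lemma invertible_op_scaleR:
  assumes "invertible_op T" "r \<noteq> 0"
  shows "invertible_op (r *\<^sub>R T)"
  unfolding invertible_op_def
  by (rule exI[of _ "inverse r *\<^sub>R inv_op T"]) (simp add: assms inv_op)

lemma invertible_op_bounded_below:
  assumes "invertible_op T"
  obtains c where "c > 0" "\<And>x. c * norm x \<le> norm (T \<cdot> x)"
proof
  \<comment> \<open>The added 1 keeps the constant positive on the zero space, where the inverse has
    norm 0.\<close>
  let ?K = "norm (inv_op T) + 1"
  show "1 / ?K > 0"
    by (simp add: add_nonneg_pos)
  fix x
  have "norm x = norm ((inv_op T * T) \<cdot> x)"
    by (simp add: inv_op assms del: bop_apply_simps(5))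
  also have "\<dots> \<le> norm (inv_op T) * norm (T \<cdot> x)"
    by (simp add: norm_bop_apply)
  also have "\<dots> \<le> ?K * norm (T \<cdot> x)"
    by (simp add: mult_right_mono)
  finally show "1 / ?K * norm x \<le> norm (T \<cdot> x)"
    by (simp add: pos_divide_le_eq add_nonneg_pos mult.commute)
qed

text \<open>A solution of \<open>T x = y\<close> is a fixed point of \<open>x \<mapsto> x - \<rho> (T x - y)\<close>, a contraction for
  small \<open>\<rho> > 0\<close>.\<close>

lemma coercive_invertible_op:
  fixes T :: "'a::complex_hilbert bop"
  assumes "c > 0" and coercive: "\<And>x. c * (norm x)\<^sup>2 \<le> inner (T \<cdot> x) x"
  shows "invertible_op T"
proof -
  \<comment> \<open>This \<open>\<rho>\<close> minimises
    \<open>1 - 2 * \<rho> * c + \<rho>\<^sup>2 * M\<^sup>2\<close>, with minimum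
    \<open>k\<^sup>2\<close>. Adding c to the norm makes M positive and at least c, so the root is
    real.\<close>
  define M where "M = norm T + c"
  define \<rho> where "\<rho> = c / M\<^sup>2"
  define k where "k = sqrt (1 - c\<^sup>2 / M\<^sup>2)"
  have M: "M > 0" "c \<le> M" "norm T \<le> M"
    using \<open>c > 0\<close> by (auto simp: M_def add_nonneg_pos)
  have "\<rho> > 0" using M \<open>c > 0\<close> by (simp add: \<rho>_def)
  have "c\<^sup>2 \<le> M\<^sup>2" using M \<open>c > 0\<close> by (simp add: power_mono)
  then have k: "0 \<le> k" "k < 1" and k2: "k\<^sup>2 = 1 - c\<^sup>2 / M\<^sup>2"
    using M \<open>c > 0\<close> by (auto simp: k_def)
  have contr: "norm (x - \<rho> *\<^sub>R (T \<cdot> x)) \<le> k * norm x" for x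
  proof (rule power2_le_imp_le)
    have "(norm (T \<cdot> x))\<^sup>2 \<le> (M * norm x)\<^sup>2"
      using norm_bop_apply[of T x] mult_right_mono[OF M(3) norm_ge_zero[of x]]
      by (intro power_mono) auto
    then have "\<rho>\<^sup>2 * (norm (T \<cdot> x))\<^sup>2 \<le> \<rho>\<^sup>2 * (M\<^sup>2 * (norm x)\<^sup>2)"
      by (simp add: power_mult_distrib mult_left_mono)
    moreover have "2 * \<rho> * inner (T \<cdot> x) x \<ge> 2 * \<rho> * (c * (norm x)\<^sup>2)"
      using coercive[of x] \<open>\<rho> > 0\<close> by simp
    moreover have "(norm (x - \<rho> *\<^sub>R (T \<cdot> x)))\<^sup>2
        = (norm x)\<^sup>2 - 2 * \<rho> * inner (T \<cdot> x) x + \<rho>\<^sup>2 * (norm (T \<cdot> x))\<^sup>2"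
      unfolding power2_norm_eq_inner
      by (simp add: inner_simps inner_commute[of x "T \<cdot> x"] power2_eq_square algebra_simps)
    ultimately have "(norm (x - \<rho> *\<^sub>R (T \<cdot> x)))\<^sup>2
        \<le> (norm x)\<^sup>2 - 2 * \<rho> * (c * (norm x)\<^sup>2) + \<rho>\<^sup>2 * (M\<^sup>2 * (norm x)\<^sup>2)"
      by linarith
    also have "\<dots> = (k * norm x)\<^sup>2"
      using M by (simp add: power_mult_distrib k2 \<rho>_def power_divide)
        (simp add: field_simps power2_eq_square power4_eq_xxxx)
    finally show "(norm (x - \<rho> *\<^sub>R (T \<cdot> x)))\<^sup>2 \<le> (k * norm x)\<^sup>2" .
  qed (use k in simp)
  have ex1: "\<exists>!x. T \<cdot> x = y" for y
  proof -
    have "\<exists>!x. x - \<rho> *\<^sub>R (T \<cdot> x - y) = x"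
    proof (rule banach_fix_type[OF k], intro allI)
      fix u v
      show "dist (u - \<rho> *\<^sub>R (T \<cdot> u - y)) (v - \<rho> *\<^sub>R (T \<cdot> v - y)) \<le> k * dist u v"
        using contr[of "u - v"] by (simp add: dist_norm bop_apply_right algebra_simps)
    qed
    then show ?thesis
      using \<open>\<rho> > 0\<close> by auto
  qed
  define g where "g y = (THE x. T \<cdot> x = y)" for y
  have Tg: "T \<cdot> g y = y" for y
    unfolding g_def by (rule theI'[OF ex1])
  have g: "T \<cdot> x = y \<Longrightarrow> g y = x" for x y
    using ex1 Tg by blast
  have g_le: "norm (g y) \<le> norm y * (1 / c)" for y
  proof (cases "g y = 0")
    case False
    have "c * (norm (g y))\<^sup>2 \<le> norm y * norm (g y)"
      using coercive[of "g y"] norm_cauchy_schwarz[of y "g y"] by (simp add: Tg)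
    then show ?thesis
      using False \<open>c > 0\<close> by (simp add: power2_eq_square field_simps)
  qed (use \<open>c > 0\<close> in simp)
  have bl: "bounded_linear g"
    by (rule bounded_linear_intro[OF _ _ g_le]) (auto intro!: g simp: bop_apply_right Tg)
  have "\<forall>a x. blinfun_apply (Blinfun g) (a *\<^sub>C x) = a *\<^sub>C blinfun_apply (Blinfun g) x"
    by (auto simp: bounded_linear_Blinfun_apply[OF bl] bop_apply_scaleC Tg intro!: g)
  then have G: "bop_of_blinfun (Blinfun g) \<cdot> y = g y" for y
    by (simp add: bop_apply.rep_eq bop_of_blinfun_inverse bounded_linear_Blinfun_apply[OF bl])
  have "bop_of_blinfun (Blinfun g) * T = 1" "T * bop_of_blinfun (Blinfun g) = 1"
    by (auto intro!: bop_eqI g simp: G Tg)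
  then show ?thesis
    unfolding invertible_op_def by blast
qed

section \<open>Selfadjoint and positive operators\<close>

text \<open>A relation between two given operators, since every adjoint met below is known
  explicitly. The real inner product suffices because operators are complex linear; see
  \<open>adjoint_ops_cinner\<close>.\<close>

definition adjoint_ops :: "'a::complex_hilbert bop \<Rightarrow> 'a bop \<Rightarrow> bool"
  where "adjoint_ops S T \<longleftrightarrow> (\<forall>x y. inner (S \<cdot> x) y = inner x (T \<cdot> y))"

abbreviation selfadjoint_op :: "'a::complex_hilbert bop \<Rightarrow> bool"
  where "selfadjoint_op T \<equiv> adjoint_ops T T"

lemma adjoint_opsD: "adjoint_ops S T \<Longrightarrow> inner (S \<cdot> x) y = inner x (T \<cdot> y)"
  by (simp add: adjoint_ops_def)

lemma Im_cinner: "Im (cinner x y) = inner x (\<i> *\<^sub>C y)"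
  by (simp add: inner_eq_Re_cinner cinner_scaleC_right)

text \<open>The imaginary part of the complex product is the real product with \<i> y, and T
  commutes with \<i>.\<close>

lemma adjoint_ops_cinner:
  assumes "adjoint_ops S T"
  shows "cinner (S \<cdot> x) y = cinner x (T \<cdot> y)"
  using adjoint_opsD[OF assms, of x]
  by (simp add: complex_eq_iff Im_cinner inner_eq_Re_cinner[symmetric] bop_apply_scaleC)

lemma adj_op_eqI:
  assumes "adjoint_ops S T"
  shows "adj_op S = T"
  unfolding adj_op_def
proof (rule the_equality)
  fix U assume U: "\<forall>x y. cinner (S \<cdot> x) y = cinner x (U \<cdot> y)"
  show "U = T"
  proof (rule bop_eqI)
    fix y
    have "\<forall>x. inner x (U \<cdot> y) = inner x (T \<cdot> y)"
      using U adjoint_opsD[OF assms, of _ y] by (metis inner_eq_Re_cinner)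
    then show "U \<cdot> y = T \<cdot> y"
      by (simp only: vector_eq_ldot)
  qed
qed (use assms in \<open>simp add: adjoint_ops_cinner\<close>)

lemma adjoint_ops_mult: "adjoint_ops S S' \<Longrightarrow> adjoint_ops T T' \<Longrightarrow> adjoint_ops (S * T) (T' * S')"
  by (simp add: adjoint_ops_def)

lemma selfadjoint_op_simps [simp]:
  "selfadjoint_op 1"
  "selfadjoint_op S \<Longrightarrow> selfadjoint_op T \<Longrightarrow> selfadjoint_op (S + T)"
  "selfadjoint_op S \<Longrightarrow> selfadjoint_op T \<Longrightarrow> selfadjoint_op (S - T)"
  "selfadjoint_op T \<Longrightarrow> selfadjoint_op (r *\<^sub>R T)"
  by (simp_all add: adjoint_ops_def inner_simps)

lemma selfadjoint_op_power: "selfadjoint_op T \<Longrightarrow> selfadjoint_op (T ^ n)"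
proof (induction n)
  case (Suc n)
  then show ?case
    using adjoint_ops_mult[of T T "T ^ n" "T ^ n"] by (simp add: power_commutes)
qed simp

lemma selfadjoint_op_sum: "(\<And>i. i \<in> I \<Longrightarrow> selfadjoint_op (f i)) \<Longrightarrow> selfadjoint_op (sum f I)"
  by (induction I rule: infinite_finite_induct) (auto simp: adjoint_ops_def[of 0])

lemma selfadjoint_op_limit:
  assumes "F \<longlonglongrightarrow> S" and "\<And>n. selfadjoint_op (F n)"
  shows "selfadjoint_op S"
  unfolding adjoint_ops_def
proof (intro allI)
  fix x y
  have lim: "(\<lambda>n. F n \<cdot> z) \<longlonglongrightarrow> S \<cdot> z" for z
    by (rule bounded_linear.tendsto[OF bounded_linear_bop_apply_left assms(1)])
  have "(\<lambda>n. inner (F n \<cdot> x) y) \<longlonglongrightarrow> inner (S \<cdot> x) y"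
    by (intro tendsto_inner lim tendsto_const)
  moreover have "(\<lambda>n. inner x (F n \<cdot> y)) \<longlonglongrightarrow> inner x (S \<cdot> y)"
    by (intro tendsto_inner lim tendsto_const)
  ultimately show "inner (S \<cdot> x) y = inner x (S \<cdot> y)"
    using assms(2) by (simp add: adjoint_ops_def LIMSEQ_unique)
qed

lemma selfadjoint_op_of_real_form:
  assumes real: "\<And>x. cinner (T \<cdot> x) x \<in> \<real>"
  shows "selfadjoint_op T"
proof -
  have "Im (cinner (T \<cdot> x) y) = - Im (cinner (T \<cdot> y) x)" for x y
  proof -
    have "Im (cinner (T \<cdot> (x + y)) (x + y)) = 0" "Im (cinner (T \<cdot> x) x) = 0" "Im (cinner (T \<cdot> y) y) = 0"
      using real complex_is_Real_iff by blast+
    then show ?thesis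
      by (simp add: Im_cinner bop_apply_right scaleC_add_right inner_simps)
  qed
  \<comment> \<open>Polarisation at x + y controlled the imaginary parts; replacing x by \<i> x
    turns them into real parts.\<close>
  from this[of "\<i> *\<^sub>C _"] have "Re (cinner (T \<cdot> x) y) = Re (cinner (T \<cdot> y) x)" for x y
    by (simp add: bop_apply_scaleC cinner_scaleC_left cinner_scaleC_right)
  then show ?thesis
    by (simp add: adjoint_ops_def inner_eq_Re_cinner) (metis inner_commute inner_eq_Re_cinner)
qed

lemma positive_opI:
  assumes "selfadjoint_op T" "c > 0" "\<And>x. c * (norm x)\<^sup>2 \<le> inner (T \<cdot> x) x"
  shows "positive_op T"
  unfolding positive_op_def
proof (intro conjI allI impI)
  fix x :: 'a
  have "cinner (T \<cdot> x) x = cnj (cinner (T \<cdot> x) x)"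
    using adjoint_ops_cinner[OF assms(1), of x x] cinner_commute[of x "T \<cdot> x"] by simp
  then show "cinner (T \<cdot> x) x \<in> \<real>"
    by (simp add: Reals_cnj_iff)
  assume "x \<noteq> 0"
  then have "0 < c * (norm x)\<^sup>2" using assms(2) by simp
  then show "Re (cinner (T \<cdot> x) x) > 0"
    using assms(3)[of x] by (simp add: inner_eq_Re_cinner)
qed (rule coercive_invertible_op[OF assms(2,3)])

lemma positive_op_selfadjoint:
  assumes "positive_op T"
  shows "selfadjoint_op T"
proof (rule selfadjoint_op_of_real_form)
  fix x show "cinner (T \<cdot> x) x \<in> \<real>"
    using assms by (cases "x = 0") (auto simp: positive_op_def bop_apply_right complex_is_Real_iff Im_cinner)
qed

text \<open>Pointwise positivity becomes a uniform bound through invertibility: the form dominates a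
  multiple of the squared norm of T x, and T is bounded below.\<close>

lemma positive_op_coercive:
  assumes "positive_op T"
  obtains c where "c > 0" "\<And>x. c * (norm x)\<^sup>2 \<le> inner (T \<cdot> x) x"
proof (cases "T = 0")
  case True
  \<comment> \<open>An invertible zero operator lives on the zero space, where any constant
    works.\<close>
  have "(x :: 'a) = 0" for x
    using assms True unfolding positive_op_def invertible_op_def
    by (metis bop_apply_simps(6,7) mult_zero_right)
  then have "1 * (norm x)\<^sup>2 \<le> inner (T \<cdot> x) x" for x
    by (metis bop_apply_right(4) inner_zero_right mult_zero_right norm_zero order_refl power_zero_numeral)
  then show ?thesis
    using that[of 1] by simp
next
  case False
  obtain k where k: "k > 0" "\<And>x. k * norm x \<le> norm (T \<cdot> x)"
    using assms invertible_op_bounded_below unfolding positive_op_def by metis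
  \<comment> \<open>This s maximises \<open>2 * s - s\<^sup>2 * norm T\<close>, the coefficient
    obtained below; the maximum is s itself.\<close>
  define s where "s = 1 / norm T"
  have s: "s > 0" "s * norm T = 1" using False by (simp_all add: s_def)
  have pos: "inner (T \<cdot> x) x \<ge> 0" for x
    using assms by (cases "x = 0") (auto simp: positive_op_def inner_eq_Re_cinner[symmetric] order_less_imp_le)
  show ?thesis
  proof (rule that[of "s * k\<^sup>2"])
    fix x
    let ?y = "T \<cdot> x"
    \<comment> \<open>Positivity at \<open>x - s T x\<close> bounds the form at \<open>x\<close> below by \<open>s \<parallel>T x\<parallel>\<^sup>2\<close>.\<close>
    have "0 \<le> inner (T \<cdot> (x - s *\<^sub>R ?y)) (x - s *\<^sub>R ?y)" by (rule pos)
    also have "\<dots> = inner ?y x - 2 * s * (norm ?y)\<^sup>2 + s\<^sup>2 * inner (T \<cdot> ?y) ?y"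
      using adjoint_opsD[OF positive_op_selfadjoint[OF assms], of ?y x]
      unfolding power2_norm_eq_inner
      by (simp add: bop_apply_right inner_simps power2_eq_square algebra_simps)
    also have "\<dots> \<le> inner ?y x - 2 * s * (norm ?y)\<^sup>2 + s\<^sup>2 * (norm T * (norm ?y)\<^sup>2)"
      using norm_cauchy_schwarz[of "T \<cdot> ?y" ?y] mult_right_mono[OF norm_bop_apply[of T ?y] norm_ge_zero[of ?y]]
      by (intro add_left_mono mult_left_mono) (simp_all add: power2_eq_square mult.assoc)
    also have "\<dots> = inner ?y x - 2 * s * (norm ?y)\<^sup>2 + s * (s * norm T) * (norm ?y)\<^sup>2"
      by (simp add: power2_eq_square mult_ac)
    finally have "s * (norm ?y)\<^sup>2 \<le> inner ?y x"
      using s(2) by simp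
    moreover have "s * (k * norm x)\<^sup>2 \<le> s * (norm ?y)\<^sup>2"
      using s(1) k by (intro mult_left_mono power_mono) auto
    ultimately show "s * k\<^sup>2 * (norm x)\<^sup>2 \<le> inner ?y x"
      by (simp add: power_mult_distrib mult.assoc)
  qed (use s k in simp)
qed

text \<open>The form of \<open>W * T * Z\<close> at x is the form of T at Z x, so the coercivity of
  T and the lower bound of Z combine.\<close>

lemma positive_op_conj:
  assumes T: "positive_op T" and adj: "adjoint_ops Z W" and Z: "invertible_op Z"
  shows "positive_op (W * T * Z)"
proof -
  note sa = positive_op_selfadjoint[OF T]
  obtain c where c: "c > 0" "\<And>x. c * (norm x)\<^sup>2 \<le> inner (T \<cdot> x) x"
    using positive_op_coercive[OF T] by metis
  obtain k where k: "k > 0" "\<And>x. k * norm x \<le> norm (Z \<cdot> x)"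
    using invertible_op_bounded_below[OF Z] by metis
  have adj': "inner (W \<cdot> u) v = inner u (Z \<cdot> v)" for u v
    by (metis adj adjoint_opsD inner_commute)
  show ?thesis
  proof (rule positive_opI)
    show "selfadjoint_op (W * T * Z)"
      using adj sa by (simp add: adjoint_ops_def adj')
    fix x
    have "(k * norm x)\<^sup>2 \<le> (norm (Z \<cdot> x))\<^sup>2"
      using k by (intro power_mono) auto
    then have "c * (k * norm x)\<^sup>2 \<le> c * (norm (Z \<cdot> x))\<^sup>2"
      using c(1) by simp
    also have "\<dots> \<le> inner (T \<cdot> (Z \<cdot> x)) (Z \<cdot> x)" by (rule c)
    finally show "c * k\<^sup>2 * (norm x)\<^sup>2 \<le> inner ((W * T * Z) \<cdot> x) x"
      by (simp add: adj' power_mult_distrib mult.assoc)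
  qed (use c k in simp)
qed

lemma positive_op_1: "positive_op 1"
  by (rule positive_opI[of _ 1]) (simp_all add: power2_norm_eq_inner)

section \<open>Polynomials of a selfadjoint operator\<close>

lemma poly_op_altdef: "degree p \<le> n \<Longrightarrow> poly_op p T = (\<Sum>i\<le>n. coeff p i *\<^sub>R T ^ i)"
  unfolding poly_op_def by (rule sum.mono_neutral_left) (auto simp: coeff_eq_0)

lemma poly_op_pCons: "poly_op (pCons a p) T = a *\<^sub>R 1 + T * poly_op p T"
proof -
  have "poly_op (pCons a p) T = (\<Sum>i\<le>Suc (degree p). coeff (pCons a p) i *\<^sub>R T ^ i)"
    by (rule poly_op_altdef) (simp add: degree_pCons_le)
  also have "\<dots> = a *\<^sub>R 1 + T * poly_op p T"
    by (simp add: sum.atMost_Suc_shift poly_op_def sum_distrib_left del: sum.atMost_Suc)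
  finally show ?thesis .
qed

lemma poly_op_0: "poly_op 0 T = 0"
  by (simp add: poly_op_def)

lemma poly_op_const: "poly_op [:a:] T = a *\<^sub>R 1"
  by (simp add: poly_op_pCons poly_op_0)

lemma poly_op_1: "poly_op 1 T = 1"
  using poly_op_const[of 1 T] by (simp add: one_pCons)

lemma poly_op_linear: "poly_op [:a, b:] T = a *\<^sub>R 1 + b *\<^sub>R T"
  by (simp add: poly_op_pCons poly_op_0)

lemma poly_op_diff: "poly_op (p - q) T = poly_op p T - poly_op q T"
proof -
  let ?n = "max (degree p) (degree q)"
  have "degree (p - q) \<le> ?n" by (rule degree_diff_le_max)
  then show ?thesis
    by (simp add: poly_op_altdef[of _ ?n] scaleR_diff_left sum_subtractf)
qed

lemma poly_op_add: "poly_op (p + q) T = poly_op p T + poly_op q T"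
  using poly_op_diff[of "p + q" q T] by simp

lemma poly_op_smult: "poly_op (smult a p) T = a *\<^sub>R poly_op p T"
  by (simp add: poly_op_altdef[of _ "degree p"] poly_op_def[of p] degree_smult_le scaleR_sum_right)

lemma poly_op_mult: "poly_op (p * q) T = poly_op p T * poly_op q T"
  by (induction p) (simp_all add: poly_op_0 poly_op_pCons poly_op_add poly_op_smult algebra_simps)

lemma selfadjoint_poly_op: "selfadjoint_op T \<Longrightarrow> selfadjoint_op (poly_op p T)"
  unfolding poly_op_def by (intro selfadjoint_op_sum selfadjoint_op_simps selfadjoint_op_power)

text \<open>Induction carries Z past one factor at a time. Limits later extend this to real
  powers.\<close>

lemma poly_op_intertwine:
  assumes "Z * S = T * Z"
  shows "Z * poly_op p S = poly_op p T * Z"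
proof (induction p)
  case (pCons a p)
  have "Z * (S * poly_op p S) = T * (Z * poly_op p S)"
    by (metis assms mult.assoc)
  also have "\<dots> = T * poly_op p T * Z"
    by (simp only: pCons.IH mult.assoc)
  finally show ?case
    by (simp add: poly_op_pCons algebra_simps)
qed (simp add: poly_op_0)

section \<open>Real polynomials and their complex roots\<close>

lemma map_poly_of_real_add:
  "map_poly complex_of_real (p + q) = map_poly of_real p + map_poly of_real q"
  by (rule poly_eqI) (simp add: coeff_map_poly)

lemma poly_map_poly_of_real_mult:
  "poly (map_poly complex_of_real (p * q)) z = poly (map_poly of_real p) z * poly (map_poly of_real q) z"
  by (induction p)
    (simp_all add: map_poly_of_real_add map_poly_pCons map_poly_smult algebra_simps)

lemma real_poly_root_or_quadratic_factor:
  fixes p :: "real poly"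
  assumes "degree p > 0"
  obtains (root) r where "poly p r = 0"
    | (quadratic) a b where "b \<noteq> 0" "[:a\<^sup>2 + b\<^sup>2, - 2 * a, 1:] dvd p"
proof -
  have "degree (map_poly complex_of_real p) = degree p"
    by (rule map_poly_degree_eq) (use assms in auto)
  then obtain z where z: "poly (map_poly complex_of_real p) z = 0"
    using assms fundamental_theorem_of_algebra constant_degree by (metis less_irrefl)
  show thesis
  proof (cases "Im z = 0")
    case True
    then have "poly (map_poly complex_of_real p) (complex_of_real (Re z)) = 0"
      using z complex_is_Real_iff of_real_Re by metis
    moreover have "poly (map_poly complex_of_real p) (complex_of_real x) = complex_of_real (poly p x)" for x
      by (induction p) (simp_all add: map_poly_pCons)
    ultimately have "poly p (Re z) = 0" by simp
    then show thesis by (rule root)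
  next
    case False
    \<comment> \<open>This is the product of x - z and x - \<open>cnj z\<close>. The remainder of p
      modulo q is a + b x and vanishes at the nonreal z, which forces a = b = 0.\<close>
    define q where "q = [:(Re z)\<^sup>2 + (Im z)\<^sup>2, - 2 * Re z, 1:]"
    have "degree q = 2" "q \<noteq> 0" by (simp_all add: q_def)
    then have "degree (p mod q) < 2"
      using degree_mod_less[of q p] by auto
    then have "coeff (p mod q) i = coeff [:coeff (p mod q) 0, coeff (p mod q) 1:] i" for i
      by (cases i; cases "i - 1") (auto simp: coeff_pCons coeff_eq_0 split: nat.splits)
    then obtain a b where r: "p mod q = [:a, b:]"
      using poly_eqI by blast
    have "poly (map_poly complex_of_real (p div q * q)) z + poly (map_poly of_real (p mod q)) z = 0"
      using z by (simp flip: poly_add map_poly_of_real_add)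
    moreover have "poly (map_poly complex_of_real q) z = 0"
      by (simp add: q_def map_poly_pCons complex_eq_iff power2_eq_square algebra_simps)
    ultimately have "poly (map_poly complex_of_real (p mod q)) z = 0"
      by (simp add: poly_map_poly_of_real_mult)
    then have "b = 0 \<and> a = 0"
      using False by (auto simp: r map_poly_pCons complex_eq_iff)
    then have "q dvd p"
      using r by (simp add: dvd_eq_mod_eq_0)
    then show thesis
      using False quadratic[of "Im z" "Re z"] by (simp add: q_def)
  qed
qed

section \<open>The real spectrum\<close>

text \<open>The set on which \<open>cfc\<close> takes its uniform limits, by
  \<open>real_spectrum_eq\<close>.\<close>

definition real_spectrum :: "'a::complex_hilbert bop \<Rightarrow> real set"
  where "real_spectrum T = {r. \<not> invertible_op (T - r *\<^sub>R 1)}"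

lemma real_spectrum_eq: "{r. complex_of_real r \<in> spectrum_op T} = real_spectrum T"
proof -
  have "scalar_op (complex_of_real r) = (r *\<^sub>R 1 :: 'a bop)" for r
    by (rule bop_eqI)
      (simp add: bop_apply.rep_eq scalar_op.rep_eq bounded_linear_Blinfun_apply bounded_linear_scaleC
        scaleC_of_real bounded_linear_scaleR_right scaleR_bop.rep_eq one_bop.rep_eq blinfun.scaleR_left)
  then show ?thesis
    by (simp add: real_spectrum_def spectrum_op_def)
qed

text \<open>Below c the operator T - r is coercive, and above the norm of T so is r - T. A positive
  c keeps the spectrum away from 0, where powers may fail to be continuous.\<close>

lemma real_spectrum_subset:
  assumes c: "\<And>x. c * (norm x)\<^sup>2 \<le> inner (T \<cdot> x) x"
  shows "real_spectrum T \<subseteq> {c..norm T}"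
proof
  fix r assume "r \<in> real_spectrum T"
  then have r: "\<not> invertible_op (T - r *\<^sub>R 1)"
    by (simp add: real_spectrum_def)
  have "\<not> r < c"
  proof
    assume "r < c"
    then have "invertible_op (T - r *\<^sub>R 1)"
      using c by (intro coercive_invertible_op[of "c - r"])
        (simp_all add: inner_simps power2_norm_eq_inner algebra_simps)
    then show False using r by simp
  qed
  moreover have "\<not> norm T < r"
  proof
    assume "norm T < r"
    have "inner (T \<cdot> x) x \<le> norm T * (norm x)\<^sup>2" for x
      using norm_cauchy_schwarz[of "T \<cdot> x" x] mult_right_mono[OF norm_bop_apply[of T x] norm_ge_zero[of x]]
      by (simp add: power2_eq_square mult.assoc)
    then have "invertible_op (r *\<^sub>R 1 - T)"
      using \<open>norm T < r\<close>
      by (intro coercive_invertible_op[of "r - norm T"])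
        (simp_all add: inner_simps power2_norm_eq_inner algebra_simps)
    then show False
      using r invertible_op_scaleR[of "r *\<^sub>R 1 - T" "-1"] by simp
  qed
  ultimately show "r \<in> {c..norm T}" by simp
qed

text \<open>If \<open>T - \<mu>\<close> and \<open>T + \<mu>\<close>, with \<open>\<mu> = \<parallel>T\<parallel>\<close>, were both invertible, then \<open>T\<^sup>2 - \<mu>\<^sup>2\<close> would be
  bounded below; since \<open>\<parallel>(T\<^sup>2 - \<mu>\<^sup>2) x\<parallel>\<^sup>2 \<le> \<mu>\<^sup>2 (\<mu>\<^sup>2 \<parallel>x\<parallel>\<^sup>2 - \<parallel>T x\<parallel>\<^sup>2)\<close>, this would improve the
  bound \<open>\<parallel>T x\<parallel> \<le> \<mu> \<parallel>x\<parallel>\<close>.\<close>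

lemma norm_in_real_spectrum:
  fixes T :: "'a::complex_hilbert bop"
  assumes sa: "selfadjoint_op T" and "T \<noteq> 0"
  obtains \<mu> where "\<bar>\<mu>\<bar> = norm T" "\<mu> \<in> real_spectrum T"
proof (rule ccontr)
  define \<mu> where "\<mu> = norm T"
  have "\<mu> > 0" using \<open>T \<noteq> 0\<close> by (simp add: \<mu>_def)
  assume "\<not> thesis"
  then have "invertible_op (T - \<mu> *\<^sub>R 1)" "invertible_op (T - (- \<mu>) *\<^sub>R 1)"
    using that[of \<mu>] that[of "- \<mu>"] \<open>\<mu> > 0\<close> by (auto simp: \<mu>_def real_spectrum_def)
  then have "invertible_op ((T - \<mu> *\<^sub>R 1) * (T - (- \<mu>) *\<^sub>R 1))"
    by (rule invertible_op_mult)
  then obtain k where k: "k > 0"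
    "\<And>x. k * norm x \<le> norm (((T - \<mu> *\<^sub>R 1) * (T - (- \<mu>) *\<^sub>R 1)) \<cdot> x)"
    using invertible_op_bounded_below by metis
  define d where "d = k\<^sup>2 / \<mu>\<^sup>2"
  have "d > 0" using k \<open>\<mu> > 0\<close> by (simp add: d_def)
  have key: "d * (norm x)\<^sup>2 \<le> \<mu>\<^sup>2 * (norm x)\<^sup>2 - (norm (T \<cdot> x))\<^sup>2" for x
  proof -
    let ?y = "T \<cdot> x"
    have "(k * norm x)\<^sup>2 \<le> (norm (T \<cdot> ?y - (\<mu>\<^sup>2) *\<^sub>R x))\<^sup>2"
      using k(1) k(2)[of x]
      by (intro power_mono) (simp_all add: bop_apply_right algebra_simps power2_eq_square)
    also have "\<dots> = (norm (T \<cdot> ?y))\<^sup>2 - 2 * \<mu>\<^sup>2 * inner (T \<cdot> ?y) x + (\<mu>\<^sup>2)\<^sup>2 * (norm x)\<^sup>2"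
      unfolding power2_norm_eq_inner
      by (simp add: inner_simps inner_commute[of x "T \<cdot> (T \<cdot> x)"] power2_eq_square algebra_simps)
    also have "inner (T \<cdot> ?y) x = (norm ?y)\<^sup>2"
      by (simp add: adjoint_opsD[OF sa] power2_norm_eq_inner)
    also have "(norm (T \<cdot> ?y))\<^sup>2 \<le> (\<mu> * norm ?y)\<^sup>2"
      unfolding \<mu>_def by (intro power_mono norm_bop_apply) simp
    finally have "k\<^sup>2 * (norm x)\<^sup>2 \<le> \<mu>\<^sup>2 * (\<mu>\<^sup>2 * (norm x)\<^sup>2 - (norm ?y)\<^sup>2)"
      by (simp add: power_mult_distrib algebra_simps power2_eq_square)
    then show ?thesis
      using \<open>\<mu> > 0\<close> by (simp add: d_def divide_le_eq mult.commute)
  qed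
  have bound: "(norm (T \<cdot> x))\<^sup>2 \<le> (\<mu>\<^sup>2 - d) * (norm x)\<^sup>2" for x
    using key[of x] by (simp add: algebra_simps)
  \<comment> \<open>Otherwise \<open>bound\<close> would make T vanish. The inequality makes the
    square root below a genuine one.\<close>
  have "d \<le> \<mu>\<^sup>2"
  proof (rule ccontr)
    assume "\<not> d \<le> \<mu>\<^sup>2"
    have "T \<cdot> x = 0" for x
    proof -
      have "(\<mu>\<^sup>2 - d) * (norm x)\<^sup>2 \<le> 0"
        using \<open>\<not> d \<le> \<mu>\<^sup>2\<close> by (simp add: mult_nonpos_nonneg)
      then show ?thesis
        using bound[of x] by (metis norm_le_zero_iff order_trans power2_less_eq_zero_iff zero_eq_power2 norm_eq_zero)
    qed
    then show False
      using \<open>T \<noteq> 0\<close> by (metis bop_eqI bop_apply_simps(6))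
  qed
  have "norm T \<le> sqrt (\<mu>\<^sup>2 - d)"
  proof (rule norm_bop_le)
    fix x
    show "norm (T \<cdot> x) \<le> sqrt (\<mu>\<^sup>2 - d) * norm x"
      by (rule power2_le_imp_le) (use bound[of x] \<open>d \<le> \<mu>\<^sup>2\<close> in \<open>simp_all add: power_mult_distrib\<close>)
  qed (use \<open>d \<le> \<mu>\<^sup>2\<close> in simp)
  also have "\<dots> < sqrt (\<mu>\<^sup>2)"
    using \<open>d > 0\<close> by (intro real_sqrt_less_mono) simp
  finally show False
    using \<open>\<mu> > 0\<close> by (simp add: \<mu>_def)
qed

text \<open>One inclusion of the spectral mapping theorem. Factors with invertible value at T are
  split off by induction on the degree. A linear factor with root outside the spectrum is of this
  kind, and so is (x - a)^2 + b^2, whose form at T is at least b^2 times the squared norm.\<close>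

lemma poly_op_not_invertible:
  fixes T :: "'a::complex_hilbert bop"
  assumes "selfadjoint_op T" "p \<noteq> 0" "\<not> invertible_op (poly_op p T)"
  shows "\<exists>r\<in>real_spectrum T. poly p r = 0"
  using assms
proof (induction "degree p" arbitrary: p rule: less_induct)
  case less
  have one: "invertible_op (1 :: 'a bop)"
    unfolding invertible_op_def by (rule exI[of _ 1]) simp
  have "degree p > 0"
  proof (rule ccontr)
    assume "\<not> degree p > 0"
    then obtain a where "p = [:a:]" "a \<noteq> 0"
      using less.prems(2) by (auto elim: degree_eq_zeroE)
    then show False
      using less.prems(3) invertible_op_scaleR[OF one] by (simp add: poly_op_const)
  qed
  have factor: "\<exists>r\<in>real_spectrum T. poly p r = 0"
    if p: "p = f * g" and f: "invertible_op (poly_op f T)" "degree f > 0" for f g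
  proof -
    have "degree g < degree p" "g \<noteq> 0"
      using f(2) less.prems(2) by (auto simp: p degree_mult_eq)
    moreover have "\<not> invertible_op (poly_op g T)"
      using less.prems(3) f(1) invertible_op_mult by (auto simp: p poly_op_mult)
    ultimately show ?thesis
      using less.hyps less.prems(1) by (fastforce simp: p)
  qed
  from \<open>degree p > 0\<close> show ?case
  proof (cases rule: real_poly_root_or_quadratic_factor)
    case (root r)
    then obtain g where g: "p = [:- r, 1:] * g"
      by (auto simp: poly_eq_0_iff_dvd dvd_def)
    show ?thesis
    proof (cases "r \<in> real_spectrum T")
      case False
      then show ?thesis
        by (intro factor[OF g]) (simp_all add: real_spectrum_def poly_op_linear)
    qed (use root in blast)
  next
    case (quadratic a b)
    then obtain g where g: "p = [:a\<^sup>2 + b\<^sup>2, - 2 * a, 1:] * g"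
      by (auto simp: dvd_def)
    let ?f = "[:a\<^sup>2 + b\<^sup>2, - 2 * a, 1:]"
    have "invertible_op (poly_op ?f T)"
    proof (rule coercive_invertible_op)
      show "b\<^sup>2 > 0" using quadratic(1) by simp
      fix x
      have "inner (poly_op ?f T \<cdot> x) x = b\<^sup>2 * (norm x)\<^sup>2 + (norm (T \<cdot> x - a *\<^sub>R x))\<^sup>2"
        unfolding power2_norm_eq_inner
        using adjoint_opsD[OF less.prems(1), of "T \<cdot> x" x]
        by (simp add: poly_op_pCons poly_op_0 bop_apply_right inner_simps power2_eq_square
            inner_commute[of x "T \<cdot> x"] inner_commute[of x "T \<cdot> (T \<cdot> x)"] algebra_simps)
      then show "b\<^sup>2 * (norm x)\<^sup>2 \<le> inner (poly_op ?f T \<cdot> x) x"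
        by simp
    qed
    then show ?thesis
      by (rule factor[OF g]) simp
  qed
qed

lemma norm_poly_op_le:
  fixes T :: "'a::complex_hilbert bop"
  assumes sa: "selfadjoint_op T" and "0 \<le> e" and e: "\<And>r. r \<in> real_spectrum T \<Longrightarrow> \<bar>poly p r\<bar> \<le> e"
  shows "norm (poly_op p T) \<le> e"
proof (cases "poly_op p T = 0")
  case False
  then have "(1 :: 'a bop) \<noteq> 0"
    by (metis mult.left_neutral mult_zero_left)
  obtain \<mu> where \<mu>: "\<bar>\<mu>\<bar> = norm (poly_op p T)" "\<mu> \<in> real_spectrum (poly_op p T)"
    using norm_in_real_spectrum[OF selfadjoint_poly_op[OF sa] False] by metis
  have "\<exists>r\<in>real_spectrum T. poly p r = \<mu>"
  proof (cases "p = [:\<mu>:]")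
    case True
    \<comment> \<open>Here \<open>p - [:\<mu>:]\<close> is the zero polynomial, so any spectral
      point serves. As the space is nontrivial there is one: 0 if T = 0, otherwise a number with
      absolute value \<open>norm T\<close>.\<close>
    have "\<exists>r. r \<in> real_spectrum T"
    proof (cases "T = 0")
      case True
      then have "0 \<in> real_spectrum T"
        using \<open>1 \<noteq> 0\<close> by (simp add: real_spectrum_def invertible_op_def)
      then show ?thesis ..
    qed (use norm_in_real_spectrum[OF sa] in metis)
    then show ?thesis
      using True by simp
  next
    case False
    have "\<not> invertible_op (poly_op (p - [:\<mu>:]) T)"
      using \<mu>(2) by (simp add: real_spectrum_def poly_op_diff poly_op_const)
    then show ?thesis
      using poly_op_not_invertible[OF sa, of "p - [:\<mu>:]"] False by auto
  qed
  then obtain r where "r \<in> real_spectrum T" "poly p r = \<mu>" by blast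
  then show ?thesis
    using e[of r] \<mu>(1) by simp
qed (use \<open>0 \<le> e\<close> in simp)

section \<open>Functional calculus\<close>

lemma poly_op_tendsto_0:
  assumes sa: "selfadjoint_op T"
    and ul: "uniform_limit (real_spectrum T) (\<lambda>n. poly (p n)) (\<lambda>_. 0) sequentially"
  shows "(\<lambda>n. poly_op (p n) T) \<longlonglongrightarrow> 0"
proof (rule tendstoI)
  fix e :: real assume "e > 0"
  then have "\<forall>\<^sub>F n in sequentially. \<forall>r\<in>real_spectrum T. dist (poly (p n) r) 0 < e / 2"
    by (intro uniform_limitD[OF ul]) simp
  then show "\<forall>\<^sub>F n in sequentially. dist (poly_op (p n) T) 0 < e"
  proof (rule eventually_mono)
    fix n assume "\<forall>r\<in>real_spectrum T. dist (poly (p n) r) 0 < e / 2"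
    then have "norm (poly_op (p n) T) \<le> e / 2"
      using \<open>e > 0\<close> by (intro norm_poly_op_le[OF sa]) (auto intro: less_imp_le)
    then show "dist (poly_op (p n) T) 0 < e"
      using \<open>e > 0\<close> by simp
  qed
qed

text \<open>The norm bound turns uniform Cauchy sequences of polynomials into Cauchy sequences of
  operators. Two approximations of f differ by polynomials tending uniformly to 0, so the limit
  named by \<open>cfc\<close> is unique.\<close>

lemma tendsto_cfc:
  fixes T :: "'a::complex_hilbert bop"
  assumes sa: "selfadjoint_op T"
    and ul: "uniform_limit (real_spectrum T) (\<lambda>n. poly (p n)) f sequentially"
  shows "(\<lambda>n. poly_op (p n) T) \<longlonglongrightarrow> cfc f T"
proof -
  have "Cauchy (\<lambda>n. poly_op (p n) T)"
  proof (rule CauchyI)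
    fix e :: real assume "e > 0"
    then obtain N where N: "dist (poly (p n) r) (f r) < e / 3" if "n \<ge> N" "r \<in> real_spectrum T" for n r
      using uniform_limitD[OF ul, of "e / 3"] by (auto simp: eventually_sequentially)
    have "norm (poly_op (p m) T - poly_op (p n) T) < e" if "m \<ge> N" "n \<ge> N" for m n
    proof -
      have "norm (poly_op (p m - p n) T) \<le> 2 * e / 3"
      proof (rule norm_poly_op_le[OF sa])
        fix r assume r: "r \<in> real_spectrum T"
        show "\<bar>poly (p m - p n) r\<bar> \<le> 2 * e / 3"
          using N[OF that(1) r] N[OF that(2) r] unfolding dist_real_def poly_diff by linarith
      qed (use \<open>e > 0\<close> in simp)
      then show ?thesis
        using \<open>e > 0\<close> by (simp add: poly_op_diff)
    qed
    then show "\<exists>N. \<forall>m\<ge>N. \<forall>n\<ge>N. norm (poly_op (p m) T - poly_op (p n) T) < e"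
      by blast
  qed
  then obtain L where L: "(\<lambda>n. poly_op (p n) T) \<longlonglongrightarrow> L"
    using Cauchy_convergent convergent_def by blast
  have "cfc f T = L"
    unfolding cfc_def real_spectrum_eq
  proof (rule the_equality)
    fix S assume "\<exists>q :: nat \<Rightarrow> real poly.
      uniform_limit (real_spectrum T) (\<lambda>n. poly (q n)) f sequentially \<and> (\<lambda>n. poly_op (q n) T) \<longlonglongrightarrow> S"
    then obtain q where q: "uniform_limit (real_spectrum T) (\<lambda>n. poly (q n)) f sequentially"
      "(\<lambda>n. poly_op (q n) T) \<longlonglongrightarrow> S" by blast
    have "poly (q n - p n) = (\<lambda>r. poly (q n) r - poly (p n) r)" for n
      by auto
    then have "uniform_limit (real_spectrum T) (\<lambda>n. poly (q n - p n)) (\<lambda>_. 0) sequentially"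
      using uniform_limit_minus[OF q(1) ul] by simp
    then have "(\<lambda>n. poly_op (q n - p n) T) \<longlonglongrightarrow> 0"
      by (rule poly_op_tendsto_0[OF sa])
    moreover have "(\<lambda>n. poly_op (q n - p n) T) \<longlonglongrightarrow> S - L"
      unfolding poly_op_diff by (intro tendsto_diff q(2) L)
    ultimately have "0 = S - L"
      by (rule LIMSEQ_unique)
    then show "S = L" by simp
  qed (rule exI[of _ p], rule conjI[OF ul L])
  then show ?thesis
    using L by simp
qed

lemma cfc_eq_poly_op:
  assumes "selfadjoint_op T" "\<And>r. r \<in> real_spectrum T \<Longrightarrow> poly p r = f r"
  shows "cfc f T = poly_op p T"
proof -
  have "uniform_limit (real_spectrum T) (\<lambda>n. poly p) f sequentially"
    by (rule uniform_limitI) (simp add: assms(2))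
  then show ?thesis
    by (rule LIMSEQ_unique[OF tendsto_cfc[OF assms(1)] tendsto_const])
qed

lemma uniform_limit_poly:
  fixes f :: "real \<Rightarrow> real"
  assumes "continuous_on {a..b} f"
  obtains p :: "nat \<Rightarrow> real poly" where "uniform_limit {a..b} (\<lambda>n. poly (p n)) f sequentially"
proof -
  have "\<exists>p. \<forall>x\<in>{a..b}. \<bar>f x - poly p x\<bar> < e" if "e > 0" for e
  proof -
    obtain g where g: "real_polynomial_function g" "\<And>x. x \<in> {a..b} \<Longrightarrow> \<bar>f x - g x\<bar> < e"
      using Stone_Weierstrass_real_polynomial_function[OF compact_Icc assms \<open>e > 0\<close>] by metis
    then obtain c n where "g = (\<lambda>x. \<Sum>i\<le>n. c i * x ^ i)"
      using real_polynomial_function_iff_sum by blast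
    then have "poly (\<Sum>i\<le>n. monom (c i) i) x = g x" for x
      by (simp add: poly_sum poly_monom)
    then show ?thesis
      using g(2) by metis
  qed
  then have "\<forall>n. \<exists>p. \<forall>x\<in>{a..b}. \<bar>f x - poly p x\<bar> < inverse (real (Suc n))"
    by simp
  from choice[OF this] obtain p :: "nat \<Rightarrow> real poly"
    where p: "\<And>n x. x \<in> {a..b} \<Longrightarrow> \<bar>f x - poly (p n) x\<bar> < inverse (real (Suc n))"
    by blast
  have "uniform_limit {a..b} (\<lambda>n. poly (p n)) f sequentially"
  proof (rule uniform_limitI)
    fix e :: real assume "e > 0"
    then have "\<forall>\<^sub>F n in sequentially. inverse (real (Suc n)) < e"
      using LIMSEQ_inverse_real_of_nat order_tendstoD(2) by blast
    then show "\<forall>\<^sub>F n in sequentially. \<forall>x\<in>{a..b}. dist (poly (p n) x) (f x) < e"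
    proof (eventually_elim, intro ballI)
      fix n x assume "inverse (real (Suc n)) < e" "x \<in> {a..b}"
      then show "dist (poly (p n) x) (f x) < e"
        using p[of x n] by (simp add: dist_real_def abs_minus_commute)
    qed
  qed
  then show thesis by (rule that)
qed

section \<open>Real powers of positive operators\<close>

lemma positive_op_real_spectrum:
  assumes "positive_op T"
  obtains c where "c > 0" "real_spectrum T \<subseteq> {c..norm T}"
  using positive_op_coercive[OF assms] real_spectrum_subset by metis

lemma continuous_on_powr_Icc: "0 < c \<Longrightarrow> continuous_on {c..d} (\<lambda>r::real. r powr s)"
  by (intro continuous_intros) auto

text \<open>One compact interval in the positive reals contains both spectra, so a single polynomial
  sequence serves both operators. Sharing it is what lets intertwining relations pass to the
  limit.\<close>

lemma powr_op_approx:
  fixes S T :: "'a::complex_hilbert bop"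
  assumes S: "positive_op S" and T: "positive_op T"
  obtains p where "(\<lambda>n. poly_op (p n) S) \<longlonglongrightarrow> powr_op S s" "(\<lambda>n. poly_op (p n) T) \<longlonglongrightarrow> powr_op T s"
proof -
  obtain a where a: "a > 0" "real_spectrum S \<subseteq> {a..norm S}"
    using positive_op_real_spectrum[OF S] .
  obtain b where b: "b > 0" "real_spectrum T \<subseteq> {b..norm T}"
    using positive_op_real_spectrum[OF T] .
  let ?I = "{min a b..max (norm S) (norm T)}"
  have "continuous_on ?I (\<lambda>r. r powr s)"
    using a(1) b(1) by (intro continuous_on_powr_Icc) simp
  then obtain p where p: "uniform_limit ?I (\<lambda>n. poly (p n)) (\<lambda>r. r powr s) sequentially"
    using uniform_limit_poly by blast
  have lim: "(\<lambda>n. poly_op (p n) U) \<longlonglongrightarrow> powr_op U s"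
    if "positive_op U" "real_spectrum U \<subseteq> ?I" for U :: "'a bop"
    unfolding powr_op_def
    by (intro tendsto_cfc positive_op_selfadjoint uniform_limit_on_subset[OF p] that)
  have I: "real_spectrum S \<subseteq> ?I" "real_spectrum T \<subseteq> ?I"
    using a(2) b(2) by force+
  show thesis
    by (rule that[of p, OF lim[OF S I(1)] lim[OF T I(2)]])
qed

lemma selfadjoint_powr_op:
  assumes "positive_op T"
  shows "selfadjoint_op (powr_op T s)"
  using powr_op_approx[OF assms assms, of s]
    selfadjoint_op_limit selfadjoint_poly_op positive_op_selfadjoint[OF assms] by metis

lemma powr_op_intertwine:
  assumes "positive_op S" "positive_op T" "Z * S = T * Z"
  shows "Z * powr_op S s = powr_op T s * Z"
proof -
  obtain p where p: "(\<lambda>n. poly_op (p n) S) \<longlonglongrightarrow> powr_op S s" "(\<lambda>n. poly_op (p n) T) \<longlonglongrightarrow> powr_op T s"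
    using powr_op_approx[OF assms(1,2)] .
  have "(\<lambda>n. Z * poly_op (p n) S) \<longlonglongrightarrow> Z * powr_op S s"
    by (intro tendsto_mult tendsto_const p)
  moreover have "(\<lambda>n. Z * poly_op (p n) S) \<longlonglongrightarrow> powr_op T s * Z"
    unfolding poly_op_intertwine[OF assms(3)] by (intro tendsto_mult tendsto_const p)
  ultimately show ?thesis
    by (rule LIMSEQ_unique)
qed

lemma powr_op_add:
  assumes T: "positive_op T"
  shows "powr_op T (s + u) = powr_op T s * powr_op T u"
proof -
  note sa = positive_op_selfadjoint[OF T]
  obtain c where c: "c > 0" "real_spectrum T \<subseteq> {c..norm T}"
    using positive_op_real_spectrum[OF T] .
  let ?I = "{c..norm T}"
  \<comment> \<open>Uniform limits may be multiplied because the limit functions are bounded on the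
    interval.\<close>
  have bdd: "bounded ((\<lambda>r. r powr v) ` ?I)" for v :: real
    using continuous_on_powr_Icc[OF c(1)] compact_continuous_image compact_imp_bounded by blast
  obtain p where p: "uniform_limit ?I (\<lambda>n. poly (p n)) (\<lambda>r. r powr s) sequentially"
    using uniform_limit_poly continuous_on_powr_Icc[OF c(1)] by blast
  obtain q where q: "uniform_limit ?I (\<lambda>n. poly (q n)) (\<lambda>r. r powr u) sequentially"
    using uniform_limit_poly continuous_on_powr_Icc[OF c(1)] by blast
  have "poly (p n * q n) = (\<lambda>r. poly (p n) r * poly (q n) r)" for n
    by auto
  then have pq: "uniform_limit ?I (\<lambda>n. poly (p n * q n)) (\<lambda>r. r powr (s + u)) sequentially"
    using uniform_lim_mult[OF p q bdd bdd] by (simp add: powr_add)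
  note lim = tendsto_cfc[OF sa uniform_limit_on_subset[OF _ c(2)]]
  have "(\<lambda>n. poly_op (p n) T * poly_op (q n) T) \<longlonglongrightarrow> powr_op T (s + u)"
    using lim[OF pq] by (simp add: poly_op_mult powr_op_def)
  moreover have "(\<lambda>n. poly_op (p n) T * poly_op (q n) T) \<longlonglongrightarrow> powr_op T s * powr_op T u"
    unfolding powr_op_def by (intro tendsto_mult lim p q)
  ultimately show ?thesis
    by (rule LIMSEQ_unique)
qed

lemma positive_op_real_spectrum_pos:
  assumes "positive_op T" "r \<in> real_spectrum T"
  shows "r > 0"
proof -
  obtain c where "c > 0" "real_spectrum T \<subseteq> {c..norm T}"
    using positive_op_real_spectrum[OF assms(1)] .
  then have "c \<le> r" using assms(2) by auto
  then show ?thesis using \<open>c > 0\<close> by simp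
qed

text \<open>Positivity of the spectrum enters because \<open>r powr 0\<close> equals 1 only for r
  different from 0.\<close>

lemma powr_op_0:
  assumes "positive_op T"
  shows "powr_op T 0 = 1"
  unfolding powr_op_def
  by (subst cfc_eq_poly_op[where p = 1])
    (auto simp: poly_op_1 assms positive_op_selfadjoint dest: positive_op_real_spectrum_pos[OF assms])

lemma powr_op_1:
  assumes "positive_op T"
  shows "powr_op T 1 = T"
  unfolding powr_op_def
  by (subst cfc_eq_poly_op[where p = "[:0, 1:]"])
    (auto simp: poly_op_linear assms positive_op_selfadjoint dest: positive_op_real_spectrum_pos[OF assms])

lemma powr_op_minus:
  assumes "positive_op T"
  shows "powr_op T (- s) * powr_op T s = 1" "powr_op T s * powr_op T (- s) = 1"
  using powr_op_add[OF assms, of "- s" s] powr_op_add[OF assms, of s "- s"] powr_op_0[OF assms]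
  by simp_all

lemma invertible_powr_op: "positive_op T \<Longrightarrow> invertible_op (powr_op T s)"
  unfolding invertible_op_def using powr_op_minus by blast

text \<open>The power s is the square of the selfadjoint invertible power s / 2, hence a conjugate
  of the identity.\<close>

lemma positive_powr_op:
  assumes "positive_op T"
  shows "positive_op (powr_op T s)"
  using positive_op_conj[OF positive_op_1 selfadjoint_powr_op[OF assms] invertible_powr_op[OF assms], of "s / 2"]
    powr_op_add[OF assms, of "s / 2" "s / 2"] by simp

text \<open>Moving Z to the left through the power turns \<open>Z * W\<close> into
  \<open>W * Z\<close>; the factor \<open>W * Z\<close> then in front raises the exponent from t - 1
  to t.\<close>

lemma powr_op_conj:
  assumes C: "positive_op (Z * W)" and D: "positive_op (W * Z)"
  shows "W * powr_op (Z * W) (t - 1) * Z = powr_op (W * Z) t"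
proof -
  have "powr_op (Z * W) (t - 1) * Z = Z * powr_op (W * Z) (t - 1)"
    by (rule powr_op_intertwine[OF D C, symmetric]) (simp add: mult.assoc)
  then have "W * powr_op (Z * W) (t - 1) * Z = powr_op (W * Z) 1 * powr_op (W * Z) (t - 1)"
    by (simp add: mult.assoc powr_op_1[OF D])
  also have "\<dots> = powr_op (W * Z) t"
    by (simp flip: powr_op_add[OF D])
  finally show ?thesis .
qed

theorem theorem3p1:
  fixes A B :: "'a::complex_hilbert bop" and t :: real
  assumes "positive_op A" and "positive_op B" and "0 \<le> t" and "t \<le> 1"
  shows "positive_op (inv_op (A \<sharp>\<^bsub>1 - t\<^esub> B)) \<and>
    (sqrt_op A * sqrt_op B) * inv_op (A \<sharp>\<^bsub>1 - t\<^esub> B) * adj_op (sqrt_op A * sqrt_op B)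
      = A \<natural>\<^bsub>t\<^esub> B \<and>
    (\<forall>X. positive_op X \<and>
      (sqrt_op A * sqrt_op B) * X * adj_op (sqrt_op A * sqrt_op B) = A \<natural>\<^bsub>t\<^esub> B
        \<longrightarrow> X = inv_op (A \<sharp>\<^bsub>1 - t\<^esub> B))"
proof -
  note A = assms(1) and B = assms(2)
  define P R Q Q' where "P = sqrt_op A" "R = powr_op A (-1/2)" "Q = sqrt_op B" "Q' = powr_op B (-1/2)"
  note defs = this
  have PR: "P * R = 1" "R * P = 1" and QQ': "Q * Q' = 1" "Q' * Q = 1"
    using powr_op_minus[OF A, of "1/2"] powr_op_minus[OF B, of "1/2"] by (simp_all add: defs)
  have cancel: "P * (R * Y) = Y" "R * (P * Y) = Y" "Q * (Q' * Y) = Y" "Q' * (Q * Y) = Y" for Y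
    by (simp_all add: PR QQ' flip: mult.assoc)
  have sa: "selfadjoint_op P" "selfadjoint_op R" "selfadjoint_op Q"
    unfolding defs by (intro selfadjoint_powr_op A B)+
  have inv: "invertible_op P" "invertible_op R" "invertible_op Q"
    unfolding defs by (intro invertible_powr_op A B)+
  have PP: "P * P = A" and QQ: "Q * Q = B"
    using powr_op_add[OF A, of "1/2" "1/2"] powr_op_add[OF B, of "1/2" "1/2"]
    by (simp_all add: defs powr_op_1 A B)
  have invA: "inv_op A = R * R"
    by (rule inv_op_eqI) (simp_all add: PP[symmetric] mult.assoc cancel PR)
  \<comment> \<open>R and Q are selfadjoint, so W is the adjoint of Z.\<close>
  define Z W where "Z = R * Q" "W = Q * R"
  note ZW = this
  have C_eq: "R * B * R = Z * W" and D_eq: "Q * inv_op A * Q = W * Z"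
    by (simp_all add: ZW invA mult.assoc flip: QQ)
  have C: "positive_op (Z * W)"
    using positive_op_conj[OF B sa(2) inv(2)] by (simp add: C_eq)
  have D: "positive_op (W * Z)"
    using positive_op_conj[OF positive_op_1 _ invertible_op_mult[OF inv(2,3)], of W]
      adjoint_ops_mult[OF sa(2,3)] by (simp add: ZW)
  \<comment> \<open>The exponent is -(1 - t), so E inverts the middle factor of the mean.\<close>
  define E where "E = powr_op (Z * W) (t - 1)"
  have inv_sharp: "inv_op (A \<sharp>\<^bsub>1 - t\<^esub> B) = R * E * R"
  proof (rule inv_op_eqI)
    have E: "E * powr_op (Z * W) (1 - t) = 1" "powr_op (Z * W) (1 - t) * E = 1"
      using powr_op_minus[OF C, of "1 - t"] by (simp_all add: E_def)
    have E': "E * (powr_op (Z * W) (1 - t) * Y) = Y" "powr_op (Z * W) (1 - t) * (E * Y) = Y" for Y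
      by (simp_all add: E flip: mult.assoc)
    have "A \<sharp>\<^bsub>1 - t\<^esub> B = P * powr_op (Z * W) (1 - t) * P"
      by (simp only: sharp_op_def defs[symmetric] C_eq)
    then show "R * E * R * (A \<sharp>\<^bsub>1 - t\<^esub> B) = 1" "(A \<sharp>\<^bsub>1 - t\<^esub> B) * (R * E * R) = 1"
      by (simp_all add: mult.assoc cancel E' PR)
  qed
  have pos: "positive_op (R * E * R)"
    unfolding E_def by (intro positive_op_conj positive_powr_op C sa inv)
  have adj: "adj_op (P * Q) = Q * P"
    by (rule adj_op_eqI) (intro adjoint_ops_mult sa)
  have nat: "A \<natural>\<^bsub>t\<^esub> B = P * powr_op (W * Z) t * P"
    by (simp only: natural_op_def defs[symmetric] D_eq)
  have sol: "(P * Q) * (R * E * R) * (Q * P) = P * powr_op (W * Z) t * P"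
  proof -
    have "(P * Q) * (R * E * R) * (Q * P) = P * (W * E * Z) * P"
      by (simp add: ZW mult.assoc)
    then show ?thesis
      by (simp add: E_def powr_op_conj[OF C D])
  qed
  have "X = R * E * R" if "(P * Q) * X * (Q * P) = P * powr_op (W * Z) t * P" for X
  proof -
    \<comment> \<open>Any Y is recovered from \<open>(P * Q) * Y * (Q * P)\<close>, so two solutions
      of the equation coincide.\<close>
    have X: "Y = Q' * R * ((P * Q) * Y * (Q * P)) * R * Q'" for Y
      by (simp add: mult.assoc cancel PR QQ')
    show ?thesis
      by (subst (1 2) X) (simp only: that sol)
  qed
  then show ?thesis
    using pos sol unfolding defs(1,3)[symmetric] adj inv_sharp nat by blast
qed

end
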